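(* If $H$ is an acyclic digraph on $n$ vertices with maximum degree $\Delta$ and height $h$, then $$\overrightarrow{r_1}(H)\le (\Delta h)^{10\Delta\log h}\,n.$$ In particular, $\overrightarrow{r_1}(H)=O_{h,\Delta}(n)$, i.e. $\overrightarrow{r_1}(H)\le C n$ for a constant $C$ depending only on $h$ and $\Delta$.
   Context: All digraphs are finite, simple and oriented (no loops, parallel or anti-parallel edges). The maximum degree of $H$ is $\max_{v}(|N^+(v)|+|N^-(v)|)$. The height of an acyclic digraph $H$ is the number of vertices on a longest directed path in $H$. A copy of $H$ in $T$ is given by an injective map $V(H)\to V(T)$ sending edges of $H$ to edges of $T$ with orientations preserved. $\overrightarrow{r_1}(H)$ is the least $N$ such that every tournament on $N$ vertices contains a copy of $H$. All logarithms are to base $2$. *)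

theory Defs
  imports Complex_Main "Graph_Theory.Graph_Theory"
begin

text \<open>
  A \<open>pair_digraph\<close> is finite and loop-free, and its arcs form a set of pairs, so there are no
  parallel arcs; asymmetry rules out anti-parallel ones.
\<close>

definition oriented_digraph :: "'a pair_pre_digraph \<Rightarrow> bool" where
  "oriented_digraph H \<longleftrightarrow> pair_digraph H \<and> asym (parcs H)"

definition tournament :: "'a pair_pre_digraph \<Rightarrow> bool" where
  "tournament T \<longleftrightarrow> oriented_digraph T \<and> total_on (pverts T) (parcs T)"

definition acyclic_digraph :: "'a pair_pre_digraph \<Rightarrow> bool" where
  "acyclic_digraph H \<longleftrightarrow> oriented_digraph H \<and> acyclic (parcs H)"

definition out_nbrs :: "'a pair_pre_digraph \<Rightarrow> 'a \<Rightarrow> 'a set" where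
  "out_nbrs H v = {w. (v, w) \<in> parcs H}"

definition in_nbrs :: "'a pair_pre_digraph \<Rightarrow> 'a \<Rightarrow> 'a set" where
  "in_nbrs H v = {u. (u, v) \<in> parcs H}"

text \<open>
  For the digraph without vertices the next two maxima are over the empty set and hence
  unspecified; this is harmless below, where such a digraph only meets bounds of the form
  \<open>0 \<le> c * 0\<close>.
\<close>

definition max_degree :: "'a pair_pre_digraph \<Rightarrow> nat" where
  "max_degree H = Max ((\<lambda>v. card (out_nbrs H v) + card (in_nbrs H v)) ` pverts H)"

definition height :: "'a pair_pre_digraph \<Rightarrow> nat" where
  "height H = Max {length (pre_digraph.awalk_verts (with_proj H) u p) | u p v.
                     pre_digraph.apath (with_proj H) u p v}"

definition is_copy ::
  "('a \<Rightarrow> 'b) \<Rightarrow> 'a pair_pre_digraph \<Rightarrow> 'b pair_pre_digraph \<Rightarrow> bool" where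
  "is_copy f H T \<longleftrightarrow>
     f ` pverts H \<subseteq> pverts T \<and> inj_on f (pverts H) \<and>
     (\<forall>u v. (u, v) \<in> parcs H \<longrightarrow> (f u, f v) \<in> parcs T)"

definition contains_copy :: "'a pair_pre_digraph \<Rightarrow> 'b pair_pre_digraph \<Rightarrow> bool" where
  "contains_copy H T \<longleftrightarrow> (\<exists>f. is_copy f H T)"

text \<open>
  Tournaments are taken on finite sets of natural numbers, which covers all of them up to
  isomorphism. For acyclic \<open>H\<close> the minimum is attained, see \<open>oriented_ramsey_exists\<close>.
\<close>

definition unavoidable :: "'a pair_pre_digraph \<Rightarrow> nat \<Rightarrow> bool" where
  "unavoidable H N \<longleftrightarrow>
     (\<forall>T :: nat pair_pre_digraph. tournament T \<and> card (pverts T) = N \<longrightarrow> contains_copy H T)"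

definition oriented_ramsey :: "'a pair_pre_digraph \<Rightarrow> nat" where
  "oriented_ramsey H = (LEAST N. unavoidable H N)"

text \<open>
  Real exponentiation with \<open>x\<^sup>0 = 1\<close> for all \<open>x\<close>, whereas \<open>0 powr 0 = 0\<close>. The case \<open>0\<^sup>0\<close> arises for
  digraphs without arcs, where \<open>\<Delta> = 0\<close>.
\<close>

definition real_pow :: "real \<Rightarrow> real \<Rightarrow> real" where
  "real_pow x y = (if y = 0 then 1 else x powr y)"

lemma transitive_sub_tournament:
  assumes "finite V" "total_on V R" "2 ^ k \<le> card V"
  shows "\<exists>ts. length ts = k \<and> distinct ts \<and> set ts \<subseteq> V \<and> sorted_wrt (\<lambda>x y. (x, y) \<in> R) ts"
  using assms
proof (induction k arbitrary: V)
  case 0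
  show ?case by (rule exI[of _ "[]"]) simp
next
  case (Suc k)
  have "card V \<noteq> 0" using Suc.prems(3) by (metis le_zero_eq power_not_zero zero_neq_numeral)
  then obtain v where v: "v \<in> V" by fastforce
  define A where "A = {w \<in> V - {v}. (v, w) \<in> R}"
  define B where "B = {w \<in> V - {v}. (w, v) \<in> R}"
  have fin: "finite A" "finite B" using Suc.prems(1) by (auto simp: A_def B_def)
  have AB: "V - {v} = A \<union> B" using Suc.prems(2) v by (auto simp: A_def B_def total_on_def)
  have "card (V - {v}) = card V - 1" using v by (rule card_Diff_singleton)
  then have "card V - 1 \<le> card A + card B"
    using card_Un_le[of A B] by (simp only: AB)
  then have "2 ^ k \<le> card A \<or> 2 ^ k \<le> card B" using Suc.prems(3) by fastforce
  then show ?case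
  proof
    assume "2 ^ k \<le> card A"
    moreover have "total_on A R" using Suc.prems(2) by (auto simp: A_def total_on_def)
    ultimately obtain ts where "length ts = k" "distinct ts" "set ts \<subseteq> A"
      "sorted_wrt (\<lambda>x y. (x, y) \<in> R) ts" using Suc.IH fin by blast
    then show ?thesis using v by (intro exI[of _ "v # ts"]) (auto simp: A_def)
  next
    assume "2 ^ k \<le> card B"
    moreover have "total_on B R" using Suc.prems(2) by (auto simp: B_def total_on_def)
    ultimately obtain ts where "length ts = k" "distinct ts" "set ts \<subseteq> B"
      "sorted_wrt (\<lambda>x y. (x, y) \<in> R) ts" using Suc.IH fin by blast
    then show ?thesis using v by (intro exI[of _ "ts @ [v]"]) (auto simp: B_def sorted_wrt_append)
  qed
qed

lemma acyclic_ordering: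
  assumes "finite A" "finite r" "acyclic r"
  shows "\<exists>xs. distinct xs \<and> set xs = A \<and> sorted_wrt (\<lambda>x y. (y, x) \<notin> r) xs"
  using assms(1)
proof (induction "card A" arbitrary: A)
  case 0
  then show ?case by (intro exI[of _ "[]"]) simp
next
  case (Suc n)
  have "wf r" using assms(2,3) by (rule finite_acyclic_wf)
  moreover have "A \<noteq> {}" using Suc.hyps(2) by auto
  ultimately obtain m where m: "m \<in> A" "\<And>y. (y, m) \<in> r \<Longrightarrow> y \<notin> A"
    by (meson ex_in_conv wfE_min)
  have "n = card (A - {m})" using Suc.hyps(2) m(1) by simp
  then obtain xs where "distinct xs" "set xs = A - {m}" "sorted_wrt (\<lambda>x y. (y, x) \<notin> r) xs"
    using Suc.hyps(1)[of "A - {m}"] Suc.prems by auto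
  then show ?case using m by (intro exI[of _ "m # xs"]) auto
qed

lemma oriented_ramsey_exists:
  assumes "acyclic_digraph H"
  shows "\<exists>N. unavoidable H N"
proof -
  have pd: "pair_digraph H" and ac: "acyclic (parcs H)"
    using assms by (auto simp: acyclic_digraph_def oriented_digraph_def)
  interpret pair_digraph H by (rule pd)
  obtain xs where xs: "distinct xs" "set xs = pverts H"
    "sorted_wrt (\<lambda>x y. (y, x) \<notin> parcs H) xs"
    using acyclic_ordering[OF pair_finite_verts pair_finite_arcs ac] by blast
  have "contains_copy H T"
    if T: "tournament T" "card (pverts T) = 2 ^ length xs" for T :: "nat pair_pre_digraph"
  proof -
    have "finite (pverts T)" "total_on (pverts T) (parcs T)"
      using T(1) by (auto simp: tournament_def oriented_digraph_def pair_digraph_def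
          pair_fin_digraph_def pair_fin_digraph_axioms_def)
    then obtain ts where ts: "length ts = length xs" "distinct ts" "set ts \<subseteq> pverts T"
      "sorted_wrt (\<lambda>x y. (x, y) \<in> parcs T) ts"
      using transitive_sub_tournament T(2) by (metis order_refl)
    define f where "f x = the (map_of (zip xs ts) x)" for x
    have f: "f (xs ! i) = ts ! i" if "i < length xs" for i
      using that ts(1) xs(1) by (simp add: f_def map_of_zip_nth)
    have "f ` pverts H \<subseteq> pverts T"
      using f ts(1,3) xs(2) by (auto simp: in_set_conv_nth simp flip: xs(2)) (metis nth_mem subsetD)
    moreover have "inj_on f (pverts H)"
    proof (rule inj_onI)
      fix x y assume "x \<in> pverts H" "y \<in> pverts H" and eq: "f x = f y"
      then obtain i j where "i < length xs" "x = xs ! i" "j < length xs" "y = xs ! j"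
        by (metis xs(2) in_set_conv_nth)
      then show "x = y" using eq f ts(1,2) by (simp add: nth_eq_iff_index_eq)
    qed
    moreover have "(f u, f v) \<in> parcs T" if uv: "(u, v) \<in> parcs H" for u v
    proof -
      have "u \<in> set xs" "v \<in> set xs" using uv wellformed' xs(2) by auto
      then obtain i j where ij: "i < length xs" "u = xs ! i" "j < length xs" "v = xs ! j"
        by (metis in_set_conv_nth)
      have "i \<noteq> j" using pair_no_loops[OF uv] ij by auto
      moreover have "\<not> j < i"
        using sorted_wrt_nth_less[OF xs(3), of j i] ij uv by auto
      ultimately have "i < j" by simp
      then show ?thesis using sorted_wrt_nth_less[OF ts(4), of i j] ij ts(1) f by simp
    qed
    ultimately show ?thesis unfolding contains_copy_def is_copy_def by blast
  qed
  then show ?thesis unfolding unavoidable_def by blast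
qed

end

(*
  If a tournament contains no copy of H, then a greedy embedding of H fails, which yields two large
  sets X and Y such that almost all arcs between them are directed from Y to X. Repeating this inside
  X and inside Y for about log h rounds gives h sets A_0, ..., A_(h-1) such that every vertex of A_i
  dominates all but a fraction 1 / (2 Delta) of A_j whenever i < j. Mapping the vertices of H at
  level j greedily into A_j then gives a copy of H after all. Each round costs a factor
  2 (4 Delta h)^Delta.
*)

theory Submission
  imports Defs
begin

section \<open>Union bound and double counting\<close>

text \<open>Union bound behind both greedy embeddings: \<open>U\<close> will hold the images already
  used, and \<open>B x\<close> the images excluded on account of the neighbour
  \<open>x\<close>.\<close>

lemma exists_avoiding:
  assumes "finite U" "finite Q" "\<And>x. x \<in> Q \<Longrightarrow> finite (B x)"
    and less: "card U + (\<Sum>x\<in>Q. card (B x)) < card C"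
  shows "\<exists>w\<in>C. w \<notin> U \<and> (\<forall>x\<in>Q. w \<notin> B x)"
proof (rule ccontr)
  assume "\<not> ?thesis"
  then have "C \<subseteq> U \<union> (\<Union>x\<in>Q. B x)" by blast
  then have "card C \<le> card (U \<union> (\<Union>x\<in>Q. B x))"
    using assms by (intro card_mono) auto
  also have "\<dots> \<le> card U + card (\<Union>x\<in>Q. B x)" by (rule card_Un_le)
  also have "card (\<Union>x\<in>Q. B x) \<le> (\<Sum>x\<in>Q. card (B x))"
    using assms(2) by (rule card_UN_le)
  finally show False using less by simp
qed

lemma Suc_le_power: "Suc q \<le> D ^ q" if "2 \<le> D" for D q :: nat
proof -
  have "Suc q \<le> 2 ^ q" by (simp add: Suc_leI)
  also have "\<dots> \<le> D ^ q" using that by (rule power_mono) simp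
  finally show ?thesis .
qed

lemma sum_card_swap:
  assumes "finite X" "finite Y"
  shows "(\<Sum>x\<in>X. card {y \<in> Y. r x y}) = (\<Sum>y\<in>Y. card {x \<in> X. r x y})"
proof -
  have "(\<Sum>x\<in>X. card {y \<in> Y. r x y}) = (\<Sum>x\<in>X. \<Sum>y\<in>Y. if r x y then 1 else 0)"
    using assms(2) by (simp add: sum.If_cases Int_def)
  also have "\<dots> = (\<Sum>y\<in>Y. \<Sum>x\<in>X. if r x y then 1 else 0)" by (rule sum.swap)
  also have "\<dots> = (\<Sum>y\<in>Y. card {x \<in> X. r x y})"
    using assms(1) by (simp add: sum.If_cases Int_def)
  finally show ?thesis .
qed

text \<open>Markov's inequality by double counting the pairs in \<open>r\<close> between
  \<open>X\<close> and \<open>Y\<close>: \<open>D\<close> times their number is at most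
  \<open>card X * card Y\<close>, while \<open>c\<close> times the number of pairs at a single bad
  \<open>y\<close> exceeds \<open>card X\<close>.\<close>

lemma card_many_bad:
  fixes c D :: nat
  assumes "finite X" "finite Y" "card X > 0"
    and sparse: "\<And>x. x \<in> X \<Longrightarrow> D * card {y \<in> Y. r x y} \<le> card Y"
  shows "D * card {y \<in> Y. card X < c * card {x \<in> X. r x y}} \<le> c * card Y"
proof -
  define Z where "Z = {y \<in> Y. card X < c * card {x \<in> X. r x y}}"
  have Z: "finite Z" "Z \<subseteq> Y" using assms(2) by (auto simp: Z_def)
  have "card Z * card X = (\<Sum>y\<in>Z. card X)" by simp
  also have "\<dots> \<le> (\<Sum>y\<in>Z. c * card {x \<in> X. r x y})"
    by (rule sum_mono) (simp add: Z_def)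
  also have "\<dots> \<le> (\<Sum>y\<in>Y. c * card {x \<in> X. r x y})"
    using Z assms(2) by (intro sum_mono2) auto
  also have "\<dots> = c * (\<Sum>x\<in>X. card {y \<in> Y. r x y})"
    using sum_card_swap[OF assms(1,2), of r] by (simp add: sum_distrib_left)
  finally have "D * (card Z * card X) \<le> D * (c * (\<Sum>x\<in>X. card {y \<in> Y. r x y}))"
    by (rule mult_le_mono2)
  also have "\<dots> = c * (\<Sum>x\<in>X. D * card {y \<in> Y. r x y})"
    by (simp add: sum_distrib_left mult.left_commute)
  also have "\<dots> \<le> c * (\<Sum>x\<in>X. card Y)"
    by (intro mult_le_mono2 sum_mono sparse)
  finally have "card X * (D * card Z) \<le> card X * (c * card Y)"
    by (simp add: algebra_simps)
  then show ?thesis using assms(3) by (simp add: Z_def)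
qed

section \<open>Greedy embedding of layered digraphs\<close>

text \<open>Acyclicity enters only through a function increasing along arcs. It fixes the order of
  embedding, and later the index of the set that receives a vertex.\<close>

locale layered_digraph =
  fixes W :: "'a set" and E :: "('a \<times> 'a) set" and level :: "'a \<Rightarrow> nat" and \<Delta> :: nat
  assumes finite_W: "finite W"
    and E_subset: "E \<subseteq> W \<times> W"
    and level_less: "(u, v) \<in> E \<Longrightarrow> level u < level v"
    and degree_le: "v \<in> W \<Longrightarrow> card {x. (v, x) \<in> E} + card {u. (u, v) \<in> E} \<le> \<Delta>"
begin

text \<open>The host is a vertex set with a separate relation, so that the recursion can shrink
  \<open>V\<close> and leave \<open>R\<close> alone. \<open>S\<close> is the part embedded so
  far.\<close>

definition partial_copy :: "'b set \<Rightarrow> ('b \<times> 'b) set \<Rightarrow> 'a set \<Rightarrow> ('a \<Rightarrow> 'b) \<Rightarrow> bool" where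
  "partial_copy V R S f \<longleftrightarrow> f ` S \<subseteq> V \<and> inj_on f S \<and>
     (\<forall>u v. (u, v) \<in> E \<longrightarrow> u \<in> S \<longrightarrow> v \<in> S \<longrightarrow> (f u, f v) \<in> R)"

definition down_closed :: "'a set \<Rightarrow> bool" where
  "down_closed S \<longleftrightarrow> (\<forall>u v. (u, v) \<in> E \<longrightarrow> v \<in> S \<longrightarrow> u \<in> S)"

lemma partial_copy_mono: "partial_copy V R S f \<Longrightarrow> V \<subseteq> V' \<Longrightarrow> partial_copy V' R S f"
  by (auto simp: partial_copy_def)

text \<open>As \<open>S\<close> is down-closed, no arc leads from \<open>v\<close> into
  \<open>S\<close>, and levels exclude a loop at \<open>v\<close>. So only the arcs into
  \<open>v\<close> constrain \<open>w\<close>.\<close>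

lemma partial_copy_insert:
  assumes "partial_copy V R S f" "down_closed S" "v \<notin> S" "w \<in> V" "w \<notin> f ` S"
    and "\<And>u. (u, v) \<in> E \<Longrightarrow> (f u, w) \<in> R"
  shows "partial_copy V R (insert v S) (f(v := w))"
  using assms level_less[of v v]
  unfolding partial_copy_def down_closed_def by (auto simp: inj_on_def)

lemma finite_nbrs: "finite {u. (u, v) \<in> E}" "finite {x. (v, x) \<in> E}"
proof -
  have "{u. (u, v) \<in> E} \<subseteq> W" "{x. (v, x) \<in> E} \<subseteq> W" using E_subset by auto
  then show "finite {u. (u, v) \<in> E}" "finite {x. (v, x) \<in> E}"
    using finite_W finite_subset by blast+
qed

text \<open>Induction scheme for both embeddings: \<open>P\<close> is the invariant, and vertices
  are added one by one in order of level.\<close>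

lemma greedy_extension:
  assumes base: "P {} f0"
    and step: "\<And>S f v. S \<subseteq> W \<Longrightarrow> down_closed S \<Longrightarrow> v \<in> W - S \<Longrightarrow> {u. (u, v) \<in> E} \<subseteq> S \<Longrightarrow>
      P S f \<Longrightarrow> \<exists>w. P (insert v S) (f(v := w))"
  shows "\<exists>f. P W f"
proof -
  have "\<exists>S f. S \<subseteq> W \<and> card S = m \<and> down_closed S \<and> P S f" if "m \<le> card W" for m
    using that
  proof (induction m)
    case 0
    then show ?case using base by (auto simp: down_closed_def intro!: exI[of _ "{}"])
  next
    case (Suc m)
    then obtain S f where S: "S \<subseteq> W" "card S = m" "down_closed S" "P S f" by auto
    have "W - S \<noteq> {}" using S Suc.prems by auto
    then obtain v where v: "v \<in> W - S" "\<And>x. x \<in> W - S \<Longrightarrow> level v \<le> level x"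
      using ex_has_least_nat[of "\<lambda>x. x \<in> W - S" _ level] by blast
    \<comment> \<open>In-neighbours of \<open>v\<close> have smaller level, and \<open>v\<close> has
      least level outside \<open>S\<close>.\<close>
    have nb: "{u. (u, v) \<in> E} \<subseteq> S"
      using v level_less E_subset by fastforce
    obtain w where "P (insert v S) (f(v := w))" using step[OF S(1,3) v(1) nb S(4)] by blast
    moreover have "card (insert v S) = Suc m"
      using S v(1) finite_W finite_subset by fastforce
    moreover have "down_closed (insert v S)" using S(3) nb by (auto simp: down_closed_def)
    ultimately show ?case using S(1) v(1) by blast
  qed
  then obtain S f where "S \<subseteq> W" "card S = card W" "P S f" by blast
  then show ?thesis using card_subset_eq[OF finite_W] by metis
qed

text \<open>
  Greedy embedding in order of increasing level. \<open>cand S f v\<close> is the set of possible images of a vertex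
  \<open>v\<close> outside \<open>S\<close>; each embedded in-neighbour of \<open>v\<close> shrinks it by a factor of at most \<open>D\<close>. Images
  that would shrink it more are dominated by almost all of \<open>cand S f v\<close>, so if there are many of them,
  then they form the sparse pair together with it.
\<close>

lemma copy_or_sparse_pair:
  fixes V :: "'b set" and D s :: nat
  assumes V: "finite V" "total_on V R" "D ^ \<Delta> * s \<le> card V"
    and D: "2 \<le> D" and s: "card W \<le> s"
    and no_copy: "\<not> (\<exists>f. partial_copy V R W f)"
  shows "\<exists>X Y. X \<subseteq> V \<and> Y \<subseteq> V \<and> s \<le> card X \<and> s \<le> card Y \<and>
    (\<forall>x\<in>X. D * card {y \<in> Y. y \<noteq> x \<and> (y, x) \<notin> R} \<le> card Y)"
proof (rule ccontr)
  assume no_pair: "\<not> ?thesis"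
  define cand where "cand S f v = {y \<in> V. \<forall>u\<in>S. (u, v) \<in> E \<longrightarrow> (f u, y) \<in> R}" for S f v
  define emb where "emb S v = {u \<in> S. (u, v) \<in> E}" for S v
  \<comment> \<open>The loss so far is multiplied out, which avoids division. For empty
    \<open>S\<close> this is the assumed size of \<open>V\<close>.\<close>
  define P where "P S f \<longleftrightarrow> partial_copy V R S f \<and>
    (\<forall>v\<in>W - S. D ^ \<Delta> * s \<le> card (cand S f v) * D ^ card (emb S v))" for S f
  have fin_cand: "finite (cand S f v)" for S f v using V(1) by (simp add: cand_def)
  have "\<exists>f. P W f"
  proof (rule greedy_extension)
    show "P {} (\<lambda>_. undefined)"
      using V by (simp add: P_def partial_copy_def cand_def emb_def)
  next
    fix S f v
    assume S: "S \<subseteq> W" "down_closed S" and v: "v \<in> W - S" "{u. (u, v) \<in> E} \<subseteq> S" and P: "P S f"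
    define Q where "Q = {x. (v, x) \<in> E}"
    have Q: "x \<in> W - S" "x \<noteq> v" if "x \<in> Q" for x
      using that S(2) v(1) E_subset level_less[of v v] by (auto simp: Q_def down_closed_def)
    \<comment> \<open>A vertex with at most \<open>\<Delta> - q\<close> embedded in-neighbours has a
      factor \<open>D ^ q\<close> to spare. This is needed with \<open>q = 0\<close> for
      out-neighbours of \<open>v\<close>, and with \<open>q = card Q\<close> for \<open>v\<close>
      itself.\<close>
    have cand_large: "D ^ q * s \<le> card (cand S f x)" if "x \<in> W - S" "q + card (emb S x) \<le> \<Delta>" for x q
    proof -
      have "D ^ card (emb S x) * (D ^ q * s) = D ^ (q + card (emb S x)) * s"
        by (simp add: power_add)
      also have "\<dots> \<le> D ^ \<Delta> * s"
        using that D by (intro mult_le_mono1 power_increasing) auto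
      also have "\<dots> \<le> D ^ card (emb S x) * card (cand S f x)"
        using P that(1) by (auto simp: P_def mult.commute)
      finally show ?thesis using D by simp
    qed
    \<comment> \<open>By totality the vertices \<open>y\<close> counted here are dominated by
      \<open>w\<close>, so any \<open>w\<close> outside \<open>bad x\<close> leaves \<open>x\<close>
      more than a fraction \<open>1 / D\<close> of its candidates. If \<open>bad x\<close> had more
      than \<open>s\<close> elements, it would form a sparse pair with
      \<open>cand S f x\<close>.\<close>
    define bad where "bad x = {w \<in> cand S f v.
        D * card {y \<in> cand S f x. y \<noteq> w \<and> (y, w) \<notin> R} \<le> card (cand S f x)}" for x
    have bad: "card (bad x) \<le> s" if "x \<in> Q" for x
    proof (rule ccontr)
      assume "\<not> ?thesis"
      then have "s \<le> card (bad x)" by simp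
      moreover have "card (emb S x) \<le> card {u. (u, x) \<in> E}"
        by (rule card_mono) (auto simp: emb_def finite_nbrs)
      then have "s \<le> card (cand S f x)"
        using cand_large[of x 0] degree_le[of x] Q[OF that] by simp
      moreover have "bad x \<subseteq> V" "cand S f x \<subseteq> V" by (auto simp: bad_def cand_def)
      ultimately show False using no_pair by (auto simp: bad_def)
    qed
    have "card S < card W" using S(1) v(1) finite_W by (intro psubset_card_mono) auto
    then have S_less: "card (f ` S) < s"
      using s card_image_le[of S f] finite_subset[OF S(1) finite_W] by simp
    \<comment> \<open>All in-neighbours of \<open>v\<close> are embedded, so the bound on the sum of
      both degrees still leaves the factor \<open>D ^ card Q\<close>.\<close>
    have "emb S v = {u. (u, v) \<in> E}" using v by (auto simp: emb_def)
    then have "D ^ card Q * s \<le> card (cand S f v)"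
      using cand_large[of v "card Q"] v degree_le[of v] by (simp add: Q_def)
    \<comment> \<open>This makes room for \<open>card Q\<close> bad sets of size at most
      \<open>s\<close>, plus fewer than \<open>s\<close> used images.\<close>
    moreover have "Suc (card Q) * s \<le> D ^ card Q * s"
      using Suc_le_power[OF D] by (rule mult_le_mono1)
    moreover have "(\<Sum>x\<in>Q. card (bad x)) \<le> card Q * s"
      using sum_bounded_above[of Q "\<lambda>x. card (bad x)" s] bad by simp
    ultimately have "card (f ` S) + (\<Sum>x\<in>Q. card (bad x)) < card (cand S f v)"
      using S_less by simp
    moreover have "finite (f ` S)" using finite_subset[OF S(1) finite_W] by simp
    moreover have "finite Q" by (simp add: Q_def finite_nbrs)
    moreover have "finite (bad x)" for x using fin_cand by (simp add: bad_def)
    ultimately obtain w where w: "w \<in> cand S f v" "w \<notin> f ` S" "\<And>x. x \<in> Q \<Longrightarrow> w \<notin> bad x"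
      using exists_avoiding[of "f ` S" Q bad "cand S f v"] by blast
    have "partial_copy V R (insert v S) (f(v := w))"
      using P S v w by (intro partial_copy_insert) (auto simp: P_def cand_def)
    moreover have "D ^ \<Delta> * s \<le> card (cand (insert v S) (f(v := w)) x) * D ^ card (emb (insert v S) x)"
      if x: "x \<in> W - insert v S" for x
    proof -
      have old: "D ^ \<Delta> * s \<le> card (cand S f x) * D ^ card (emb S x)"
        using P x by (simp add: P_def)
      show ?thesis
      proof (cases "x \<in> Q")
        case False
        then have "cand (insert v S) (f(v := w)) x = cand S f x" "emb (insert v S) x = emb S x"
          using v by (auto simp: Q_def cand_def emb_def)
        then show ?thesis using old by simp
      next
        case True
        have emb: "card (emb (insert v S) x) = Suc (card (emb S x))"
        proof -
          have "emb (insert v S) x = insert v (emb S x)" using True by (auto simp: emb_def Q_def)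
          then show ?thesis
            using v finite_subset[OF S(1) finite_W] by (simp add: emb_def)
        qed
        have "w \<in> V" using w(1) by (simp add: cand_def)
        have "{y \<in> cand S f x. y \<noteq> w \<and> (y, w) \<notin> R} \<subseteq> cand (insert v S) (f(v := w)) x"
          using V(2) \<open>w \<in> V\<close> v by (auto simp: cand_def total_on_def)
        then have "card {y \<in> cand S f x. y \<noteq> w \<and> (y, w) \<notin> R} \<le> card (cand (insert v S) (f(v := w)) x)"
          by (rule card_mono[OF fin_cand])
        then have "D * card {y \<in> cand S f x. y \<noteq> w \<and> (y, w) \<notin> R}
            \<le> D * card (cand (insert v S) (f(v := w)) x)"
          by (rule mult_le_mono2)
        moreover have "card (cand S f x) < D * card {y \<in> cand S f x. y \<noteq> w \<and> (y, w) \<notin> R}"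
          using w(1) w(3)[OF True] by (simp add: bad_def not_le)
        ultimately have "card (cand S f x) \<le> D * card (cand (insert v S) (f(v := w)) x)"
          by linarith
        then have "card (cand S f x) * D ^ card (emb S x)
            \<le> D * card (cand (insert v S) (f(v := w)) x) * D ^ card (emb S x)"
          by (rule mult_le_mono1)
        also have "\<dots> = card (cand (insert v S) (f(v := w)) x) * D ^ card (emb (insert v S) x)"
          by (simp add: emb)
        finally show ?thesis using old by linarith
      qed
    qed
    ultimately show "\<exists>w. P (insert v S) (f(v := w))" by (auto simp: P_def)
  qed
  then show False using no_copy by (auto simp: P_def)
qed

section \<open>Sequences of sets with dense forward arcs\<close>

text \<open>The sets may overlap, hence the exclusion \<open>y \<noteq> x\<close>; injectivity is
  secured only during the embedding.\<close>

definition dense_seq :: "'b set \<Rightarrow> ('b \<times> 'b) set \<Rightarrow> nat \<Rightarrow> nat \<Rightarrow> nat \<Rightarrow> (nat \<Rightarrow> 'b set) \<Rightarrow> bool" where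
  "dense_seq V R c t m A \<longleftrightarrow> (\<forall>i<m. A i \<subseteq> V \<and> t \<le> card (A i)) \<and>
     (\<forall>j<m. \<forall>i<j. \<forall>x\<in>A i. c * card {y \<in> A j. y \<noteq> x \<and> (x, y) \<notin> R} \<le> card (A j))"

text \<open>
  Restricting \<open>Y\<close> to \<open>Z\<close> only after the sequence \<open>A\<close> in \<open>X\<close> has been found makes the density between
  \<open>Z\<close> and every \<open>A j\<close> survive all later passages to subsets of \<open>Z\<close>. So every pair of sets pays for its
  density only once, and \<open>c\<close> does not degrade during the recursion.
\<close>

lemma copy_or_dense_seq:
  fixes V :: "'b set" and D c t :: nat
  assumes "finite V" "total_on V R" "(2 * D ^ \<Delta>) ^ k * t \<le> card V"
    and "2 \<le> D" "c * 2 ^ k \<le> D" "card W \<le> t" "0 < t" "0 < c"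
    and "\<not> (\<exists>f. partial_copy V R W f)"
  shows "\<exists>A. dense_seq V R c t (2 ^ k) A"
  using assms
proof (induction k arbitrary: V)
  case 0
  then show ?case by (intro exI[of _ "\<lambda>_. V"]) (simp add: dense_seq_def)
next
  case (Suc k)
  define s where "s = (2 * D ^ \<Delta>) ^ k * t"
  have "t \<le> s" using Suc.prems(4) by (simp add: s_def)
  \<comment> \<open>The pair is requested with size \<open>2 * s\<close> because up to half of
    \<open>Y\<close> will be discarded. This accounts for the 2 in
    \<open>2 * D ^ \<Delta>\<close>.\<close>
  have "D ^ \<Delta> * (2 * s) \<le> card V" using Suc.prems(3) by (simp add: s_def algebra_simps)
  then obtain X Y where X: "X \<subseteq> V" "2 * s \<le> card X" and Y: "Y \<subseteq> V" "2 * s \<le> card Y"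
    and XY: "\<And>x. x \<in> X \<Longrightarrow> D * card {y \<in> Y. y \<noteq> x \<and> (y, x) \<notin> R} \<le> card Y"
    using copy_or_sparse_pair[OF Suc.prems(1,2), of D "2 * s"] Suc.prems \<open>t \<le> s\<close> by force
  have sub: "\<exists>A. dense_seq Z R c t (2 ^ k) A" if "Z \<subseteq> V" "s \<le> card Z" for Z
  proof (rule Suc.IH)
    show "finite Z" using that Suc.prems(1) finite_subset by blast
    show "total_on Z R" using that(1) Suc.prems(2) by (auto simp: total_on_def)
    show "(2 * D ^ \<Delta>) ^ k * t \<le> card Z" using that by (simp add: s_def)
    show "\<not> (\<exists>f. partial_copy Z R W f)"
      using Suc.prems(9) partial_copy_mono that(1) by blast
    show "c * 2 ^ k \<le> D" using Suc.prems(5) by simp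
  qed (use Suc.prems in auto)
  have fin: "finite X" "finite Y" using X Y Suc.prems(1) finite_subset by auto
  obtain A where A: "dense_seq X R c t (2 ^ k) A" using sub[of X] X by auto
  have A_sub: "A j \<subseteq> X" "t \<le> card (A j)" if "j < 2 ^ k" for j
    using A that by (auto simp: dense_seq_def)
  \<comment> \<open>\<open>XY\<close> limits the missing arcs at each vertex of \<open>X\<close>,
    whereas the sequence needs a limit at each vertex on the \<open>Y\<close> side. The vertices of
    \<open>Y\<close> that violate it for some \<open>A j\<close> are removed.\<close>
  define bad where "bad j = {y \<in> Y. card (A j) < c * card {x \<in> A j. x \<noteq> y \<and> (y, x) \<notin> R}}" for j
  define Z where "Z = {y \<in> Y. \<forall>j<2 ^ k. c * card {x \<in> A j. x \<noteq> y \<and> (y, x) \<notin> R} \<le> card (A j)}"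
  have bad: "D * card (bad j) \<le> c * card Y" if "j < 2 ^ k" for j
    unfolding bad_def
  proof (rule card_many_bad)
    show "finite (A j)" using A_sub[OF that] fin finite_subset by blast
    show "0 < card (A j)" using A_sub[OF that] Suc.prems(7) by simp
    fix x assume "x \<in> A j"
    then have "D * card {y \<in> Y. y \<noteq> x \<and> (y, x) \<notin> R} \<le> card Y" using A_sub(1)[OF that] XY by blast
    then show "D * card {y \<in> Y. x \<noteq> y \<and> (y, x) \<notin> R} \<le> card Y"
      by (simp add: eq_commute)
  qed (use fin in auto)
  have "Y - Z \<subseteq> (\<Union>j<2 ^ k. bad j)" by (auto simp: Z_def bad_def not_le)
  moreover have "finite (\<Union>j<2 ^ k. bad j)" using fin by (auto simp: bad_def)
  ultimately have "card (Y - Z) \<le> card (\<Union>j<2 ^ k. bad j)" by (simp add: card_mono)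
  also have "\<dots> \<le> (\<Sum>j<2 ^ k. card (bad j))" by (rule card_UN_le) simp
  finally have "D * card (Y - Z) \<le> (\<Sum>j<2 ^ k. D * card (bad j))"
    by (simp flip: sum_distrib_left)
  also have "\<dots> \<le> (\<Sum>j<2 ^ k::nat. c * card Y)" by (rule sum_mono) (simp add: bad)
  finally have "D * card (Y - Z) \<le> (c * 2 ^ k) * card Y" by (simp add: algebra_simps)
  \<comment> \<open>Since \<open>D\<close> is at least \<open>c * 2 ^ Suc k\<close>, the
    \<open>2 ^ k\<close> bad sets together cover at most half of \<open>Y\<close>.\<close>
  moreover have "(c * 2 ^ k) * (2 * card (Y - Z)) \<le> D * card (Y - Z)"
    using mult_le_mono1[OF Suc.prems(5), of "card (Y - Z)"] by (simp add: algebra_simps)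
  ultimately have "(c * 2 ^ k) * (2 * card (Y - Z)) \<le> (c * 2 ^ k) * card Y" by linarith
  then have "2 * card (Y - Z) \<le> card Y" using Suc.prems(8) by simp
  moreover have "card (Y - Z) = card Y - card Z"
    using fin by (intro card_Diff_subset) (auto simp: Z_def)
  ultimately have "s \<le> card Z" using Y by linarith
  moreover have "Z \<subseteq> V" using Y by (auto simp: Z_def)
  ultimately obtain B where B: "dense_seq Z R c t (2 ^ k) B" using sub by blast
  have B_sub: "B j \<subseteq> Z" "t \<le> card (B j)" if "j < 2 ^ k" for j
    using B that by (auto simp: dense_seq_def)
  \<comment> \<open>Almost all arcs go from \<open>Y\<close> to \<open>X\<close>, so the sets inside
    \<open>Z\<close> come first.\<close>
  define F where "F i = (if i < 2 ^ k then B i else A (i - 2 ^ k))" for i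
  have "dense_seq V R c t (2 ^ Suc k) F"
    unfolding dense_seq_def
  proof (intro conjI allI impI ballI)
    fix i :: nat assume "i < 2 ^ Suc k"
    then have i: "i - 2 ^ k < 2 ^ k" by simp
    show "F i \<subseteq> V"
      using A_sub(1)[OF i] B_sub(1)[of i] X(1) \<open>Z \<subseteq> V\<close> by (auto simp: F_def)
    show "t \<le> card (F i)"
      using A_sub(2)[OF i] B_sub(2)[of i] by (simp add: F_def)
  next
    fix i j :: nat and x
    assume j: "j < 2 ^ Suc k" "i < j" and x: "x \<in> F i"
    consider "j < 2 ^ k" | "2 ^ k \<le> i" | "i < 2 ^ k" "2 ^ k \<le> j" by linarith
    then show "c * card {y \<in> F j. y \<noteq> x \<and> (x, y) \<notin> R} \<le> card (F j)"
    proof cases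
      case 1
      then show ?thesis using B j x by (simp add: dense_seq_def F_def)
    next
      case 2
      then have "j - 2 ^ k < 2 ^ k" "i - 2 ^ k < j - 2 ^ k" using j by auto
      then show ?thesis using A 2 j x by (simp add: dense_seq_def F_def)
    next
      case 3
      then have "x \<in> Z" "j - 2 ^ k < 2 ^ k" using B_sub(1)[of i] x j by (auto simp: F_def)
      then show ?thesis using 3 by (simp add: Z_def F_def)
    qed
  qed
  then show ?case by blast
qed

text \<open>Each of the at most \<open>\<Delta>\<close> in-neighbours of a vertex excludes at most a
  fraction \<open>1 / (2 * \<Delta>)\<close> of its set, so together at most half. The other half
  has at least \<open>card W\<close> elements, more than the images already used.\<close>

lemma copy_in_dense_seq:
  assumes A: "dense_seq V R (2 * \<Delta>) (2 * card W) m A" and "finite V"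
    and "\<And>v. v \<in> W \<Longrightarrow> level v < m" and "0 < \<Delta>"
  shows "\<exists>f. partial_copy V R W f"
proof -
  define P where "P S f \<longleftrightarrow> partial_copy V R S f \<and> (\<forall>v\<in>S. f v \<in> A (level v))" for S f
  have "\<exists>f. P W f"
  proof (rule greedy_extension)
    show "P {} (\<lambda>_. undefined)" by (simp add: P_def partial_copy_def)
  next
    fix S f v
    assume S: "S \<subseteq> W" "down_closed S" and v: "v \<in> W - S" "{u. (u, v) \<in> E} \<subseteq> S" and P: "P S f"
    define C where "C = A (level v)"
    define Q where "Q = {u. (u, v) \<in> E}"
    define bad where "bad u = {y \<in> C. y \<noteq> f u \<and> (f u, y) \<notin> R}" for u
    have C: "C \<subseteq> V" "2 * card W \<le> card C"
      using A assms(3)[of v] v(1) by (auto simp: dense_seq_def C_def)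
    have fin: "finite C" "finite Q" "finite S"
      using C(1) assms(2) finite_subset S(1) finite_W by (auto simp: Q_def finite_nbrs)
    have bad: "2 * \<Delta> * card (bad u) \<le> card C" if "u \<in> Q" for u
    proof -
      have "u \<in> S" "level u < level v" using that v level_less by (auto simp: Q_def)
      then show ?thesis
        using A assms(3)[of v] v(1) P by (auto simp: dense_seq_def P_def bad_def C_def)
    qed
    have "\<Delta> * (2 * (\<Sum>u\<in>Q. card (bad u))) = (\<Sum>u\<in>Q. 2 * \<Delta> * card (bad u))"
      by (simp add: sum_distrib_left mult.assoc mult.left_commute)
    also have "\<dots> \<le> card Q * card C" using sum_bounded_above[of Q, OF bad] by simp
    also have "\<dots> \<le> \<Delta> * card C" using degree_le[of v] v(1) by (intro mult_le_mono1) (simp add: Q_def)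
    finally have "2 * (\<Sum>u\<in>Q. card (bad u)) \<le> card C" using assms(4) by simp
    moreover have "card S < card W" using S(1) v(1) finite_W by (intro psubset_card_mono) auto
    then have "card (f ` S) < card W" using card_image_le[OF fin(3), of f] by simp
    ultimately have "card (f ` S) + (\<Sum>u\<in>Q. card (bad u)) < card C" using C(2) by linarith
    then obtain w where w: "w \<in> C" "w \<notin> f ` S" "\<And>u. u \<in> Q \<Longrightarrow> w \<notin> bad u"
      using exists_avoiding[of "f ` S" Q bad C] fin by (auto simp: bad_def)
    have "(f u, w) \<in> R" if "(u, v) \<in> E" for u
      using w w(3)[of u] that v by (auto simp: bad_def Q_def)
    then have "partial_copy V R (insert v S) (f(v := w))"
      using P S v w C by (intro partial_copy_insert) (auto simp: P_def)
    then have "P (insert v S) (f(v := w))"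
      using P v w by (auto simp: P_def C_def)
    then show "\<exists>w. P (insert v S) (f(v := w))" by blast
  qed
  then show ?thesis by (auto simp: P_def)
qed

text \<open>The choice is \<open>D = 4 * \<Delta> * h\<close> and \<open>c = 2 * \<Delta>\<close>:
  the upper bound on \<open>2 ^ k\<close> gives \<open>c * 2 ^ k \<le> D\<close>, and the lower
  bound provides a set for every level.\<close>

lemma copy_in_large_tournament:
  fixes V :: "'b set"
  assumes "finite V" "total_on V R"
    and "2 * card W * (2 * (4 * \<Delta> * h) ^ \<Delta>) ^ k \<le> card V"
    and "2 ^ k \<le> 2 * h" "h \<le> 2 ^ k" "0 < \<Delta>" "\<And>v. v \<in> W \<Longrightarrow> level v < h" "W \<noteq> {}"
  shows "\<exists>f. partial_copy V R W f"
proof (rule ccontr)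
  assume no_copy: "\<not> ?thesis"
  have "h > 0" using assms(7,8) by fastforce
  have "card W > 0" using assms(8) finite_W by auto
  have "1 \<le> \<Delta> * h" using assms(6) \<open>h > 0\<close> by (simp add: Suc_leI)
  then have "2 \<le> 4 * \<Delta> * h" by linarith
  moreover have "2 * \<Delta> * 2 ^ k \<le> 4 * \<Delta> * h"
    using mult_le_mono2[OF assms(4), of "2 * \<Delta>"] by simp
  ultimately obtain A where "dense_seq V R (2 * \<Delta>) (2 * card W) (2 ^ k) A"
    using copy_or_dense_seq[OF assms(1,2), of "4 * \<Delta> * h" k "2 * card W" "2 * \<Delta>"]
      assms(3,6) no_copy \<open>card W > 0\<close> by (auto simp: mult.commute)
  then show False
    using copy_in_dense_seq[of V R "2 ^ k" A] assms no_copy by (meson order_less_le_trans)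
qed

end

section \<open>Levels from longest paths\<close>

text \<open>The level of \<open>v\<close> is the height minus the number of vertices on a longest
  path starting at \<open>v\<close>.\<close>

lemma path_level_exists:
  assumes "acyclic_digraph H"
  shows "\<exists>level. (\<forall>v\<in>pverts H. level v < height H) \<and>
    (\<forall>u v. (u, v) \<in> parcs H \<longrightarrow> level u < level v)"
proof -
  have pd: "pair_digraph H" and ac: "acyclic (parcs H)"
    using assms by (auto simp: acyclic_digraph_def oriented_digraph_def)
  interpret pair_digraph H by (rule pd)
  define L where "L = {length (pawalk_verts u p) | u p v. apath u p v}"
  define Lv where "Lv u = {length (pawalk_verts u p) | p v. apath u p v}" for u
  have height: "height H = Max L" by (simp add: height_def L_def)
  have fin: "finite L"
  proof -
    have "L = (\<lambda>(u, p, v). length (pawalk_verts u p)) ` {(u, p, v). apath u p v}"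
      by (auto simp: L_def image_def)
    then show ?thesis using apaths_finite_triple by simp
  qed
  have sub: "Lv u \<subseteq> L" for u by (auto simp: L_def Lv_def)
  have finv: "finite (Lv u)" for u using fin sub finite_subset by blast
  \<comment> \<open>The one-vertex path makes these maxima positive, which keeps the levels strictly
    below the height.\<close>
  have one: "1 \<in> Lv u" if "u \<in> pverts H" for u
    unfolding Lv_def using that by (auto intro!: exI[of _ "[]"] simp: apath_Nil_iff)
  have le: "1 \<le> Max (Lv u)" "Max (Lv u) \<le> height H" if "u \<in> pverts H" for u
    using one[OF that] finv[of u] fin sub[of u] by (auto simp: height intro!: Max_mono)
  have step: "Max (Lv v) < Max (Lv u)" if uv: "(u, v) \<in> parcs H" for u v
  proof -
    have v: "v \<in> pverts H" "u \<in> pverts H" using uv wellformed' by auto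
    have "Max (Lv v) \<in> Lv v" using one[OF v(1)] finv by (intro Max_in) auto
    then obtain p w where p: "apath v p w" "Max (Lv v) = length (pawalk_verts v p)"
      by (auto simp: Lv_def)
    \<comment> \<open>If the path met \<open>u\<close>, the arc \<open>(u, v)\<close> would close a
      directed cycle. So a longest path from \<open>v\<close> can be extended backwards to
      \<open>u\<close>.\<close>
    have "u \<notin> set (pawalk_verts v p)"
    proof
      assume "u \<in> set (pawalk_verts v p)"
      then have "v \<rightarrow>\<^sup>*\<^bsub>with_proj H\<^esub> u"
        using awalk_verts_reachable_from[OF awalkI_apath[OF p(1)]] by simp
      then have "(v, u) \<in> (parcs H)\<^sup>*"
        by (auto simp: reachable_def intro: rtrancl_on_rtranclI)
      then have "(u, u) \<in> (parcs H)\<^sup>+" using uv by (rule rtrancl_into_trancl2[rotated])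
      then show False using ac by (simp add: acyclic_def)
    qed
    then have "apath u ((u, v) # p) w" using p uv by (simp add: apath_Cons_iff)
    then have "length (pawalk_verts u ((u, v) # p)) \<in> Lv u" unfolding Lv_def by blast
    then have "Suc (Max (Lv v)) \<in> Lv u" using p by simp
    then show ?thesis using Max_ge[OF finv] by fastforce
  qed
  show ?thesis
  proof (intro exI[of _ "\<lambda>v. height H - Max (Lv v)"] conjI ballI allI impI)
    fix v assume "v \<in> pverts H"
    then show "height H - Max (Lv v) < height H" using le[of v] by linarith
  next
    fix u v assume uv: "(u, v) \<in> parcs H"
    then have "u \<in> pverts H" using wellformed' by auto
    then show "height H - Max (Lv u) < height H - Max (Lv v)"
      using step[OF uv] le[of u] by linarith
  qed
qed

section \<open>From embeddings to the Ramsey number\<close>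

lemma oriented_ramsey_le: "unavoidable H N \<Longrightarrow> oriented_ramsey H \<le> N"
  unfolding oriented_ramsey_def by (rule Least_le)

lemma tournament_finite_total:
  assumes "tournament T"
  shows "finite (pverts T)" "total_on (pverts T) (parcs T)"
  using assms by (auto simp: tournament_def oriented_digraph_def pair_digraph_def
      pair_fin_digraph_def pair_fin_digraph_axioms_def)

lemma oriented_ramsey_no_arcs:
  assumes "acyclic_digraph H" "parcs H = {}"
  shows "oriented_ramsey H \<le> card (pverts H)"
proof (rule oriented_ramsey_le, unfold unavoidable_def, intro allI impI, elim conjE)
  fix T :: "nat pair_pre_digraph"
  assume T: "tournament T" "card (pverts T) = card (pverts H)"
  have "finite (pverts H)"
    using assms(1) by (auto simp: acyclic_digraph_def oriented_digraph_def pair_digraph_def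
        pair_fin_digraph_def pair_fin_digraph_axioms_def)
  then obtain f where "bij_betw f (pverts H) (pverts T)"
    using finite_same_card_bij tournament_finite_total[OF T(1)] T(2) by metis
  then show "contains_copy H T"
    using assms(2) unfolding contains_copy_def is_copy_def bij_betw_def by auto
qed

lemma degree_le_max_degree:
  assumes "acyclic_digraph H" "v \<in> pverts H"
  shows "card (out_nbrs H v) + card (in_nbrs H v) \<le> max_degree H"
proof -
  have "finite (pverts H)"
    using assms(1) by (auto simp: acyclic_digraph_def oriented_digraph_def pair_digraph_def
        pair_fin_digraph_def pair_fin_digraph_axioms_def)
  then show ?thesis using assms(2) unfolding max_degree_def by (intro Max_ge) auto
qed

lemma oriented_ramsey_le_nat:
  assumes H: "acyclic_digraph H" "pverts H \<noteq> {}" and "0 < max_degree H"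
    and k: "2 ^ k \<le> 2 * height H" "height H \<le> 2 ^ k"
  shows "oriented_ramsey H
    \<le> 2 * card (pverts H) * (2 * (4 * max_degree H * height H) ^ max_degree H) ^ k"
proof (rule oriented_ramsey_le, unfold unavoidable_def, intro allI impI, elim conjE)
  fix T :: "nat pair_pre_digraph"
  assume T: "tournament T" "card (pverts T)
      = 2 * card (pverts H) * (2 * (4 * max_degree H * height H) ^ max_degree H) ^ k"
  have pd: "pair_digraph H" using H by (auto simp: acyclic_digraph_def oriented_digraph_def)
  interpret pair_digraph H by (rule pd)
  obtain level where level: "\<And>v. v \<in> pverts H \<Longrightarrow> level v < height H"
    "\<And>u v. (u, v) \<in> parcs H \<Longrightarrow> level u < level v"
    using path_level_exists[OF H(1)] by blast
  interpret L: layered_digraph "pverts H" "parcs H" level "max_degree H"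
  proof
    show "finite (pverts H)" by (rule pair_finite_verts)
    show "parcs H \<subseteq> pverts H \<times> pverts H" using wellformed' by auto
    show "level u < level v" if "(u, v) \<in> parcs H" for u v using that by (rule level(2))
    show "card {x. (v, x) \<in> parcs H} + card {u. (u, v) \<in> parcs H} \<le> max_degree H"
      if "v \<in> pverts H" for v
      using degree_le_max_degree[OF H(1) that] by (simp add: out_nbrs_def in_nbrs_def)
  qed
  obtain f where "L.partial_copy (pverts T) (parcs T) (pverts H) f"
    using L.copy_in_large_tournament[OF tournament_finite_total[OF T(1)] _ k assms(3) level(1) H(2)]
      T(2) by auto
  then show "contains_copy H T"
    using wellformed' unfolding contains_copy_def is_copy_def L.partial_copy_def by auto
qed

text \<open>A positive degree gives an arc, whose ends have different levels. This ensures that the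
  logarithm in the exponent is at least 1.\<close>

lemma two_le_height:
  assumes "acyclic_digraph H" "pverts H \<noteq> {}" "0 < max_degree H"
  shows "2 \<le> height H"
proof -
  have pd: "pair_digraph H" using assms by (auto simp: acyclic_digraph_def oriented_digraph_def)
  interpret pair_digraph H by (rule pd)
  have "parcs H \<noteq> {}"
  proof
    assume "parcs H = {}"
    then have "max_degree H = Max ((\<lambda>_. 0) ` pverts H)"
      by (simp add: max_degree_def out_nbrs_def in_nbrs_def)
    also have "(\<lambda>_. 0 :: nat) ` pverts H = {0}" using assms(2) by auto
    finally show False using assms(3) by simp
  qed
  then obtain u v where uv: "(u, v) \<in> parcs H" by auto
  obtain level where level: "\<And>v. v \<in> pverts H \<Longrightarrow> level v < height H"
    "\<And>u v. (u, v) \<in> parcs H \<Longrightarrow> level u < level v"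
    using path_level_exists[OF assms(1)] by blast
  show ?thesis using level(1)[of v] level(2)[OF uv] wellformed'[OF uv] by simp
qed

section \<open>Numerical estimates and the final bound\<close>

text \<open>The last conjunct says \<open>k \<le> 3/2 * log 2 h\<close> without logarithms. For the
  least \<open>k\<close> with \<open>h \<le> 2 ^ k\<close> and \<open>j = k - 1\<close> one has
  \<open>2 ^ j < h\<close>; if \<open>j \<ge> 2\<close>, then \<open>2 * k \<le> 3 * j\<close>
  suffices, and smaller \<open>j\<close> are checked directly.\<close>

lemma ceiling_log2_exists:
  fixes h :: nat
  assumes "2 \<le> h"
  shows "\<exists>k. h \<le> 2 ^ k \<and> 2 ^ k \<le> 2 * h \<and> 4 ^ k \<le> h ^ 3"
proof -
  obtain k where k: "h \<le> 2 ^ k" "\<And>j. j < k \<Longrightarrow> 2 ^ j < h"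
    using exists_least_iff[of "\<lambda>k. h \<le> 2 ^ k"] less_exp[of h]
    by (metis less_imp_le not_le)
  have "k \<noteq> 0" using k(1) assms by (intro notI) simp
  then obtain j where j: "k = Suc j" by (cases k) auto
  have less: "2 ^ j < h" using k(2) j by simp
  consider "j = 0" | "j = 1" | "2 \<le> j" by linarith
  then have "4 ^ k \<le> h ^ 3"
  proof cases
    case 1
    have "(2::nat) ^ 3 \<le> h ^ 3" using assms by (intro power_mono) auto
    then show ?thesis using 1 j by simp
  next
    case 2
    then have "(3::nat) ^ 3 \<le> h ^ 3" using less by (intro power_mono) auto
    then show ?thesis using 2 j by simp
  next
    case 3
    have "(4::nat) ^ k = 2 ^ (2 * k)" by (simp add: power_mult)
    also have "\<dots> \<le> 2 ^ (j * 3)" using 3 j by (intro power_increasing) auto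
    also have "\<dots> = (2 ^ j) ^ 3" by (simp only: power_mult)
    also have "\<dots> \<le> h ^ 3" using less by (intro power_mono) auto
    finally show ?thesis .
  qed
  moreover have "2 ^ k \<le> 2 * h" using less j by simp
  ultimately show ?thesis using k(1) by blast
qed

text \<open>With \<open>x = \<Delta> * h \<ge> 2\<close>, both \<open>2 \<le> x ^ \<Delta>\<close>
  and \<open>4 \<le> x ^ 2\<close> hold, so one round costs at most
  \<open>x ^ (4 * \<Delta>)\<close>. The total exponent \<open>1 + 4 * \<Delta> * k\<close> is at
  most \<open>7 * \<Delta> * log 2 h\<close>, below the stated 10.\<close>

lemma ramsey_bound_le_powr:
  fixes \<Delta> h k :: nat
  assumes "1 \<le> \<Delta>" "2 \<le> h" "4 ^ k \<le> h ^ 3"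
  shows "real (2 * (2 * (4 * \<Delta> * h) ^ \<Delta>) ^ k) \<le> (real \<Delta> * real h) powr (10 * real \<Delta> * log 2 (real h))"
proof -
  define x where "x = real \<Delta> * real h"
  have "1 * 2 \<le> x" unfolding x_def using assms by (intro mult_mono) auto
  then have x: "2 \<le> x" by simp
  have "real ((2::nat) ^ (2 * k)) \<le> real (h ^ 3)" using assms(3) by (simp add: power_mult del: of_nat_power)
  then have "log 2 (2 ^ (2 * k)) \<le> log 2 (real h ^ 3)" using assms(2) by (intro log_mono) auto
  then have k: "2 * real k \<le> 3 * log 2 (real h)" using assms(2) by (simp add: log_nat_power)
  have "1 \<le> log 2 (real h)" using assms(2) by (simp add: le_log_iff)
  have "2 * (4 * x) ^ \<Delta> \<le> x ^ (4 * \<Delta>)"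
  proof -
    have "2 * (4 * x) ^ \<Delta> \<le> x ^ \<Delta> * (x\<^sup>2 * x) ^ \<Delta>"
    proof (rule mult_mono)
      show "2 \<le> x ^ \<Delta>" using x self_le_power[of x \<Delta>] assms(1) by simp
      have "2\<^sup>2 \<le> x\<^sup>2" using x by (intro power_mono) auto
      then show "(4 * x) ^ \<Delta> \<le> (x\<^sup>2 * x) ^ \<Delta>" using x by (intro power_mono mult_mono) auto
    qed (use x in auto)
    also have "\<dots> = x ^ (4 * \<Delta>)"
      by (simp add: power_mult_distrib flip: power_mult power_add)
    finally show ?thesis .
  qed
  then have "2 * (2 * (4 * x) ^ \<Delta>) ^ k \<le> x * (x ^ (4 * \<Delta>)) ^ k"
    using x by (intro mult_mono power_mono) auto
  also have "\<dots> = x powr (1 + real (4 * \<Delta> * k))"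
  proof -
    have "x powr (1 + real (4 * \<Delta> * k)) = x * x ^ (4 * \<Delta> * k)"
      using x by (subst powr_add, subst powr_realpow) auto
    then show ?thesis by (simp add: power_mult)
  qed
  also have "\<dots> \<le> x powr (10 * real \<Delta> * log 2 (real h))"
  proof (rule powr_mono)
    have "1 * 1 \<le> real \<Delta> * log 2 (real h)"
      using assms(1) \<open>1 \<le> log 2 (real h)\<close> by (intro mult_mono) auto
    moreover have "2 * real \<Delta> * (2 * real k) \<le> 2 * real \<Delta> * (3 * log 2 (real h))"
      using k by (intro mult_left_mono) auto
    ultimately show "1 + real (4 * \<Delta> * k) \<le> 10 * real \<Delta> * log 2 (real h)" by simp
  qed (use x in auto)
  finally show ?thesis by (simp add: x_def mult.assoc)
qed

lemma oriented_ramsey_le_real_pow: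
  assumes "acyclic_digraph H"
  shows "real (oriented_ramsey H)
    \<le> real_pow (real (max_degree H) * real (height H))
        (10 * real (max_degree H) * log 2 (real (height H))) * real (card (pverts H))"
proof -
  have pd: "pair_digraph H" using assms by (auto simp: acyclic_digraph_def oriented_digraph_def)
  interpret pair_digraph H by (rule pd)
  consider "pverts H = {}" | "pverts H \<noteq> {}" "max_degree H = 0" | "pverts H \<noteq> {}" "max_degree H > 0"
    by auto
  then show ?thesis
  proof cases
    case 1
    \<comment> \<open>The degree and height are unspecified here, but both sides are 0.\<close>
    then have "parcs H = {}" using wellformed' by fastforce
    then show ?thesis using oriented_ramsey_no_arcs[OF assms] 1 by simp
  next
    case 2
    have "(u, v) \<notin> parcs H" for u v
    proof
      assume uv: "(u, v) \<in> parcs H"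
      have "finite (out_nbrs H u)"
        using wellformed' pair_finite_verts by (auto simp: out_nbrs_def intro: finite_subset)
      then show False
        using uv 2 degree_le_max_degree[OF assms, of u] wellformed'[OF uv] by (auto simp: out_nbrs_def)
    qed
    then have "parcs H = {}" by auto
    \<comment> \<open>The exponent is 0, so \<open>real_pow\<close> is 1 and the bound is just the
      number of vertices.\<close>
    then show ?thesis using oriented_ramsey_no_arcs[OF assms] 2 by (simp add: real_pow_def)
  next
    case 3
    have h: "2 \<le> height H" using two_le_height[OF assms 3] .
    then obtain k where k: "height H \<le> 2 ^ k" "2 ^ k \<le> 2 * height H" "4 ^ k \<le> height H ^ 3"
      using ceiling_log2_exists by blast
    have "oriented_ramsey H \<le>
        2 * (2 * (4 * max_degree H * height H) ^ max_degree H) ^ k * card (pverts H)"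
      using oriented_ramsey_le_nat[OF assms 3 k(2,1)] by (simp only: mult.assoc mult.commute mult.left_commute)
    then have "real (oriented_ramsey H) \<le>
        real (2 * (2 * (4 * max_degree H * height H) ^ max_degree H) ^ k) * real (card (pverts H))"
      by (metis of_nat_le_iff of_nat_mult)
    also have "\<dots> \<le> (real (max_degree H) * real (height H)) powr
        (10 * real (max_degree H) * log 2 (real (height H))) * real (card (pverts H))"
      using ramsey_bound_le_powr[OF _ h k(3), of "max_degree H"] 3(2)
      by (intro mult_right_mono) (auto simp: Suc_le_eq)
    \<comment> \<open>The base is positive, so \<open>powr\<close> and \<open>real_pow\<close>
      agree.\<close>
    also have "\<dots> = real_pow (real (max_degree H) * real (height H))
        (10 * real (max_degree H) * log 2 (real (height H))) * real (card (pverts H))"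
      using h 3(2) by (auto simp: real_pow_def log_def)

    finally show ?thesis .
  qed
qed

theorem theorem1p4:
  shows "(\<forall>(H :: 'a pair_pre_digraph) n \<Delta> h.
            acyclic_digraph H \<and> card (pverts H) = n \<and> max_degree H = \<Delta> \<and> height H = h \<longrightarrow>
            real (oriented_ramsey H)
              \<le> real_pow (real \<Delta> * real h) (10 * real \<Delta> * log 2 (real h)) * real n)
       \<and> (\<forall>\<Delta> h. \<exists>C :: real. \<forall>(H :: 'a pair_pre_digraph) n.
            acyclic_digraph H \<and> card (pverts H) = n \<and> max_degree H = \<Delta> \<and> height H = h \<longrightarrow>
            real (oriented_ramsey H) \<le> C * real n)"
proof (intro conjI allI impI)
  fix H :: "'a pair_pre_digraph" and n \<Delta> h :: nat
  assume "acyclic_digraph H \<and> card (pverts H) = n \<and> max_degree H = \<Delta> \<and> height H = h"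
  then show "real (oriented_ramsey H)
      \<le> real_pow (real \<Delta> * real h) (10 * real \<Delta> * log 2 (real h)) * real n"
    using oriented_ramsey_le_real_pow[of H] by simp
next
  fix \<Delta> h :: nat
  show "\<exists>C. \<forall>(H :: 'a pair_pre_digraph) n.
      acyclic_digraph H \<and> card (pverts H) = n \<and> max_degree H = \<Delta> \<and> height H = h \<longrightarrow>
      real (oriented_ramsey H) \<le> C * real n"
  \<comment> \<open>The witness is the factor from the explicit bound, found by unification; it
    depends on \<open>\<Delta>\<close> and \<open>h\<close> only.\<close>
  proof (intro exI allI impI)
    fix H :: "'a pair_pre_digraph" and n :: nat
    assume "acyclic_digraph H \<and> card (pverts H) = n \<and> max_degree H = \<Delta> \<and> height H = h"
    then show "real (oriented_ramsey H)
        \<le> real_pow (real \<Delta> * real h) (10 * real \<Delta> * log 2 (real h)) * real n"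
      using oriented_ramsey_le_real_pow[of H] by simp
  qed
qed

end
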